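(* If $D$ and $E$ are continuous dcpos with bases $B_D$ and $B_E$, then $B_D\times B_E$ is a basis for the product $D\times E$. Moreover: (1) if $D$ and $E$ are pointed and for every $b\in B_D$ it is decidable whether $b=\bot$, and for every $b\in B_E$ it is decidable whether $b=\bot$, then for every $b\in B_D\times B_E$ it is decidable whether $b=\bot$; (2) if for every two elements $a,b$ of $B_D$ it is decidable whether $a\ll b$, and likewise for $B_E$, then for every two elements $a,b$ of $B_D\times B_E$ it is decidable whether $a\ll b$ in $D\times E$; (3) if for every two elements $a,b$ of $B_D$ it is decidable whether $a\sqsubseteq b$, and likewise for $B_E$, then for every two elements $a,b$ of $B_D\times B_E$ it is decidable whether $a\sqsubseteq b$ in $D\times E$.
   Context: Everything is constructive: neither excluded middle nor choice is assumed. A proposition $P$ is decidable if $P\vee\lnot P$ holds. A subset $S$ of a poset is directed if it is inhabited and any two elements of $S$ have an upper bound in $S$. A dcpo is a poset $(D,\sqsubseteq)$ in which every directed subset $S$ has a supremum $\bigsqcup S$; it is pointed if it has a least element $\bot$. Write $x\ll y$ ($x$ is way below $y$) if for every directed $S$ with $y\sqsubseteq\bigsqcup S$ there is $s\in S$ with $x\sqsubseteq s$. $D$ is continuous if for every $x$ the set $\{y\in D\mid y\ll x\}$ is directed with supremum $x$. A basis of a dcpo $D$ is a subset $B\subseteq D$ such that for every $x\in D$ the set $\{b\in B\mid b\ll x\}$ is directed with supremum $x$. The product $D\times E$ of dcpos is the Cartesian product with the componentwise order; directed suprema are computed componentwise. *)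

theory Defs
  imports "HOL-Library.Extended_Nat"
begin

text \<open>
  The mathematics is constructive, whereas the type \<^typ>\<open>bool\<close> of HOL satisfies excluded middle,
  so that every \<^typ>\<open>bool\<close>-valued proposition is trivially decidable. Truth values are therefore
  taken in an arbitrary complete Heyting algebra, and all notions are written in the
  (intuitionistic, higher-order) internal logic of Heyting-valued sets, i.e. the internal logic of
  the topos of sheaves on that algebra. Neither excluded middle nor choice is valid there in
  general. The bold connectives and quantifiers are the ones of the internal logic.
\<close>

class complete_heyting_algebra = complete_lattice +
  fixes himp :: "'a \<Rightarrow> 'a \<Rightarrow> 'a"  (infixr "\<^bold>\<longrightarrow>" 25)
  assumes le_himp_iff: "z \<le> himp x y \<longleftrightarrow> inf z x \<le> y"

abbreviation hconj :: "'h \<Rightarrow> 'h \<Rightarrow> 'h::complete_heyting_algebra"  (infixr "\<^bold>\<and>" 35)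
  where "p \<^bold>\<and> q \<equiv> inf p q"

abbreviation hdisj :: "'h \<Rightarrow> 'h \<Rightarrow> 'h::complete_heyting_algebra"  (infixr "\<^bold>\<or>" 30)
  where "p \<^bold>\<or> q \<equiv> sup p q"

abbreviation hnot :: "'h \<Rightarrow> 'h::complete_heyting_algebra"  ("\<^bold>\<not> _" [40] 40)
  where "\<^bold>\<not> p \<equiv> (p \<^bold>\<longrightarrow> bot)"

abbreviation hall :: "('x \<Rightarrow> 'h) \<Rightarrow> 'h::complete_heyting_algebra"  (binder "\<^bold>\<forall>" 10)
  where "\<^bold>\<forall>x. P x \<equiv> (INF x. P x)"

abbreviation hex :: "('x \<Rightarrow> 'h) \<Rightarrow> 'h::complete_heyting_algebra"  (binder "\<^bold>\<exists>" 10)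
  where "\<^bold>\<exists>x. P x \<equiv> (SUP x. P x)"

text \<open>Quantification over a Heyting-valued predicate \<open>A\<close>; membership in \<open>A\<close> is application of \<open>A\<close>.\<close>

definition hball :: "('x \<Rightarrow> 'h) \<Rightarrow> ('x \<Rightarrow> 'h) \<Rightarrow> 'h::complete_heyting_algebra"
  where "hball A P = (\<^bold>\<forall>x. A x \<^bold>\<longrightarrow> P x)"

definition hbex :: "('x \<Rightarrow> 'h) \<Rightarrow> ('x \<Rightarrow> 'h) \<Rightarrow> 'h::complete_heyting_algebra"
  where "hbex A P = (\<^bold>\<exists>x. A x \<^bold>\<and> P x)"

syntax
  "_hball" :: "pttrn \<Rightarrow> ('x \<Rightarrow> 'h) \<Rightarrow> 'h \<Rightarrow> 'h"  ("(3\<^bold>\<forall>_\<^bold>\<in>_./ _)" [0, 0, 10] 10)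
  "_hbex" :: "pttrn \<Rightarrow> ('x \<Rightarrow> 'h) \<Rightarrow> 'h \<Rightarrow> 'h"  ("(3\<^bold>\<exists>_\<^bold>\<in>_./ _)" [0, 0, 10] 10)
translations
  "\<^bold>\<forall>x\<^bold>\<in>A. P" \<rightleftharpoons> "CONST hball A (\<lambda>x. P)"
  "\<^bold>\<exists>x\<^bold>\<in>A. P" \<rightleftharpoons> "CONST hbex A (\<lambda>x. P)"

definition valid :: "'h::complete_heyting_algebra \<Rightarrow> bool"
  where "valid p \<longleftrightarrow> p = top"

definition decidable :: "'h \<Rightarrow> 'h::complete_heyting_algebra"
  where "decidable p = (p \<^bold>\<or> \<^bold>\<not> p)"


text \<open>The two-valued instance gives back classical logic; the chain \<^typ>\<open>enat\<close> shows that
  decidability is a genuine restriction in general.\<close>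

instantiation bool :: complete_heyting_algebra
begin
definition himp_bool :: "bool \<Rightarrow> bool \<Rightarrow> bool"
  where "himp_bool p q = (p \<longrightarrow> q)"
instance by standard (auto simp: himp_bool_def)
end

instantiation enat :: complete_heyting_algebra
begin
definition himp_enat :: "enat \<Rightarrow> enat \<Rightarrow> enat"
  where "himp_enat p q = (if p \<le> q then top else q)"
instance by standard (auto simp: himp_enat_def inf_min min_def)
end

lemma not_all_decidable: "\<not> valid (decidable (1 :: enat))"
  by (simp add: valid_def decidable_def himp_enat_def bot_enat_def top_enat_def sup_max)


text \<open>
  Heyting-valued sets: \<open>heq X x y\<close> is the truth value of \<open>x = y\<close>, and \<open>heq X x x\<close> is the truth
  value of \<open>x\<close> being an element of \<open>X\<close> (its extent). Posets carry in addition the truth value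
  \<open>hle D x y\<close> of \<open>x \<sqsubseteq> y\<close>.
\<close>

record ('a, 'h) hset =
  heq :: "'a \<Rightarrow> 'a \<Rightarrow> 'h"

record ('a, 'h) hord = "('a, 'h) hset" +
  hle :: "'a \<Rightarrow> 'a \<Rightarrow> 'h"

definition elem :: "('a, 'h::complete_heyting_algebra, 'm) hset_scheme \<Rightarrow> 'a \<Rightarrow> 'h"
  where "elem X x = heq X x x"

definition is_hset :: "('a, 'h::complete_heyting_algebra, 'm) hset_scheme \<Rightarrow> 'h"
  where "is_hset X =
    ((\<^bold>\<forall>x y. heq X x y \<^bold>\<longrightarrow> heq X y x) \<^bold>\<and>
     (\<^bold>\<forall>x y z. heq X x y \<^bold>\<and> heq X y z \<^bold>\<longrightarrow> heq X x z))"

definition Subsets :: "('a, 'h::complete_heyting_algebra, 'm) hset_scheme \<Rightarrow> ('a \<Rightarrow> 'h) \<Rightarrow> 'h"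
  where "Subsets X S =
    ((\<^bold>\<forall>x. S x \<^bold>\<longrightarrow> elem X x) \<^bold>\<and>
     (\<^bold>\<forall>x y. heq X x y \<^bold>\<and> S x \<^bold>\<longrightarrow> S y))"

text \<open>The first two conjuncts after \<open>is_hset D\<close> say that \<open>\<sqsubseteq>\<close> is a binary relation on the
  Heyting-valued set \<open>D\<close>, i.e. strict and compatible with equality.\<close>

definition poset :: "('a, 'h::complete_heyting_algebra) hord \<Rightarrow> 'h"
  where "poset D =
    (is_hset D \<^bold>\<and>
     (\<^bold>\<forall>x y. hle D x y \<^bold>\<longrightarrow> elem D x \<^bold>\<and> elem D y) \<^bold>\<and>
     (\<^bold>\<forall>x x' y y'. heq D x x' \<^bold>\<and> heq D y y' \<^bold>\<and> hle D x y \<^bold>\<longrightarrow> hle D x' y') \<^bold>\<and>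
     (\<^bold>\<forall>x\<^bold>\<in>elem D. hle D x x) \<^bold>\<and>
     (\<^bold>\<forall>x\<^bold>\<in>elem D. \<^bold>\<forall>y\<^bold>\<in>elem D. \<^bold>\<forall>z\<^bold>\<in>elem D. hle D x y \<^bold>\<and> hle D y z \<^bold>\<longrightarrow> hle D x z) \<^bold>\<and>
     (\<^bold>\<forall>x\<^bold>\<in>elem D. \<^bold>\<forall>y\<^bold>\<in>elem D. hle D x y \<^bold>\<and> hle D y x \<^bold>\<longrightarrow> heq D x y))"

definition directed :: "('a, 'h::complete_heyting_algebra) hord \<Rightarrow> ('a \<Rightarrow> 'h) \<Rightarrow> 'h"
  where "directed D S =
    ((\<^bold>\<exists>x. S x) \<^bold>\<and>
     (\<^bold>\<forall>x\<^bold>\<in>S. \<^bold>\<forall>y\<^bold>\<in>S. \<^bold>\<exists>z\<^bold>\<in>S. hle D x z \<^bold>\<and> hle D y z))"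

definition is_sup :: "('a, 'h::complete_heyting_algebra) hord \<Rightarrow> ('a \<Rightarrow> 'h) \<Rightarrow> 'a \<Rightarrow> 'h"
  where "is_sup D S u =
    (elem D u \<^bold>\<and>
     (\<^bold>\<forall>x\<^bold>\<in>S. hle D x u) \<^bold>\<and>
     (\<^bold>\<forall>v\<^bold>\<in>elem D. (\<^bold>\<forall>x\<^bold>\<in>S. hle D x v) \<^bold>\<longrightarrow> hle D u v))"

definition dcpo :: "('a, 'h::complete_heyting_algebra) hord \<Rightarrow> 'h"
  where "dcpo D =
    (poset D \<^bold>\<and> (\<^bold>\<forall>S\<^bold>\<in>Subsets D. directed D S \<^bold>\<longrightarrow> (\<^bold>\<exists>u. is_sup D S u)))"

definition is_least :: "('a, 'h::complete_heyting_algebra) hord \<Rightarrow> 'a \<Rightarrow> 'h"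
  where "is_least D u = (elem D u \<^bold>\<and> (\<^bold>\<forall>x\<^bold>\<in>elem D. hle D u x))"

definition pointed :: "('a, 'h::complete_heyting_algebra) hord \<Rightarrow> 'h"
  where "pointed D = (\<^bold>\<exists>u. is_least D u)"

definition way_below :: "('a, 'h::complete_heyting_algebra) hord \<Rightarrow> 'a \<Rightarrow> 'a \<Rightarrow> 'h"
  where "way_below D x y =
    (elem D x \<^bold>\<and> elem D y \<^bold>\<and>
     (\<^bold>\<forall>S\<^bold>\<in>Subsets D. directed D S \<^bold>\<longrightarrow>
       (\<^bold>\<forall>u. is_sup D S u \<^bold>\<longrightarrow> hle D y u \<^bold>\<longrightarrow> (\<^bold>\<exists>s\<^bold>\<in>S. hle D x s))))"

definition continuous_dcpo :: "('a, 'h::complete_heyting_algebra) hord \<Rightarrow> 'h"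
  where "continuous_dcpo D =
    (dcpo D \<^bold>\<and>
     (\<^bold>\<forall>x\<^bold>\<in>elem D. directed D (\<lambda>y. elem D y \<^bold>\<and> way_below D y x) \<^bold>\<and>
       is_sup D (\<lambda>y. elem D y \<^bold>\<and> way_below D y x) x))"

definition is_basis :: "('a, 'h::complete_heyting_algebra) hord \<Rightarrow> ('a \<Rightarrow> 'h) \<Rightarrow> 'h"
  where "is_basis D B =
    (dcpo D \<^bold>\<and> Subsets D B \<^bold>\<and>
     (\<^bold>\<forall>x\<^bold>\<in>elem D. directed D (\<lambda>b. B b \<^bold>\<and> way_below D b x) \<^bold>\<and>
       is_sup D (\<lambda>b. B b \<^bold>\<and> way_below D b x) x))"

definition prod_ord ::
  "('a, 'h::complete_heyting_algebra) hord \<Rightarrow> ('b, 'h) hord \<Rightarrow> ('a \<times> 'b, 'h) hord"  (infixr "\<^bold>\<otimes>" 80)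
  where "D \<^bold>\<otimes> E =
    \<lparr>heq = (\<lambda>p q. heq D (fst p) (fst q) \<^bold>\<and> heq E (snd p) (snd q)),
     hle = (\<lambda>p q. hle D (fst p) (fst q) \<^bold>\<and> hle E (snd p) (snd q))\<rparr>"

definition prod_sub ::
  "('a \<Rightarrow> 'h::complete_heyting_algebra) \<Rightarrow> ('b \<Rightarrow> 'h) \<Rightarrow> 'a \<times> 'b \<Rightarrow> 'h"  (infixr "\<^bold>\<times>" 80)
  where "A \<^bold>\<times> B = (\<lambda>p. A (fst p) \<^bold>\<and> B (snd p))"

text \<open>\<open>\<bottom>\<close> is only a definite description, so \<open>b = \<bottom>\<close> is read as \<open>b = u\<close> for the least element
  \<open>u\<close>; this is meant for pointed \<open>D\<close>, where \<open>u\<close> exists and is unique.\<close>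

definition decidable_bot :: "('a, 'h::complete_heyting_algebra) hord \<Rightarrow> ('a \<Rightarrow> 'h) \<Rightarrow> 'h"
  where "decidable_bot D B =
    (\<^bold>\<forall>u. is_least D u \<^bold>\<longrightarrow> (\<^bold>\<forall>b\<^bold>\<in>B. decidable (heq D b u)))"

definition decidable_way_below :: "('a, 'h::complete_heyting_algebra) hord \<Rightarrow> ('a \<Rightarrow> 'h) \<Rightarrow> 'h"
  where "decidable_way_below D B = (\<^bold>\<forall>a\<^bold>\<in>B. \<^bold>\<forall>b\<^bold>\<in>B. decidable (way_below D a b))"

definition decidable_le :: "('a, 'h::complete_heyting_algebra) hord \<Rightarrow> ('a \<Rightarrow> 'h) \<Rightarrow> 'h"
  where "decidable_le D B = (\<^bold>\<forall>a\<^bold>\<in>B. \<^bold>\<forall>b\<^bold>\<in>B. decidable (hle D a b))"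

end

theory Submission
  imports Defs
begin

text \<open>
  A truth value \<open>w\<close> with \<open>w \<le> p\<close> acts as a world forcing \<open>p\<close>. By the Kripke-Joyal
  clauses, every internal argument can be carried out at an arbitrary world that shrinks when
  a hypothesis is assumed or a witness is chosen. The mathematical core is that
  \<open>(a, b) \<ll> (c, d)\<close> in \<open>D \<times> E\<close> iff \<open>a \<ll> c\<close> and \<open>b \<ll> d\<close>. From right to left, a directed subset
  of \<open>D \<times> E\<close> is approximated through its two projections; from left to right, a directed \<open>S\<close> in
  \<open>D\<close> is tested through \<open>S \<times> {d}\<close>. Hence the basis elements way below a point of the product form
  a product of two directed sets, and decidability is inherited because a conjunction of decidable
  propositions is decidable.
\<close>

section \<open>Forcing\<close>

text \<open>The world \<open>inf w p\<close> is the largest \<open>v \<le> w\<close> with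
  \<open>v \<le> p\<close>, so testing all such \<open>v\<close> amounts to testing that one. The
  quantified form lets an internal hypothesis be assumed by passing to a smaller world.\<close>

lemma le_himp:
  fixes w :: "'h::complete_heyting_algebra"
  shows "w \<le> (p \<^bold>\<longrightarrow> q) \<longleftrightarrow> (\<forall>v\<le>w. v \<le> p \<longrightarrow> v \<le> q)"
  unfolding le_himp_iff by (meson inf.bounded_iff inf_le1 inf_le2 order_refl order_trans)

lemma le_hball:
  fixes w :: "'h::complete_heyting_algebra"
  shows "w \<le> hball A P \<longleftrightarrow> (\<forall>x. \<forall>v\<le>w. v \<le> A x \<longrightarrow> v \<le> P x)"
  by (simp add: hball_def le_INF_iff le_himp)

lemma le_hexI:
  fixes w :: "'h::complete_heyting_algebra"
  shows "w \<le> P x \<Longrightarrow> w \<le> (\<^bold>\<exists>x. P x)"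
  by (rule order_trans[OF _ SUP_upper]) auto

text \<open>An element below a supremum need not lie below any single member, so \<open>w\<close>
  itself may have no witness. For each \<open>x\<close>, the premise at the world
  \<open>inf (P x) w\<close> puts \<open>P x\<close> below \<open>himp w q\<close>; the supremum
  then lies there too, and with it \<open>w\<close>.\<close>

lemma le_hexE:
  fixes w :: "'h::complete_heyting_algebra"
  assumes ex: "w \<le> (\<^bold>\<exists>x. P x)"
    and step: "\<And>x v. v \<le> w \<Longrightarrow> v \<le> P x \<Longrightarrow> v \<le> q"
  shows "w \<le> q"
proof -
  have "(\<^bold>\<exists>x. P x) \<le> (w \<^bold>\<longrightarrow> q)"
    by (intro SUP_least, unfold le_himp_iff, rule step[OF inf_le2 inf_le1])
  then have "w \<le> (w \<^bold>\<longrightarrow> q)"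
    by (rule order_trans[OF ex])
  then show ?thesis
    by (simp add: le_himp_iff)
qed

lemma le_hbexI:
  fixes w :: "'h::complete_heyting_algebra"
  shows "w \<le> A x \<Longrightarrow> w \<le> P x \<Longrightarrow> w \<le> hbex A P"
  unfolding hbex_def by (rule le_hexI) simp

lemma le_hbexE:
  fixes w :: "'h::complete_heyting_algebra"
  assumes "w \<le> hbex A P"
    and "\<And>x v. v \<le> w \<Longrightarrow> v \<le> A x \<Longrightarrow> v \<le> P x \<Longrightarrow> v \<le> q"
  shows "w \<le> q"
  using assms(1) unfolding hbex_def by (rule le_hexE) (use assms(2) in auto)

text \<open>A world forcing a disjunction need not force either side. As for the existential
  quantifier, both sides lie below \<open>himp w r\<close>, hence so does their supremum.\<close>

lemma le_hdisjE:
  fixes w :: "'h::complete_heyting_algebra"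
  assumes disj: "w \<le> (p \<^bold>\<or> q)"
    and left: "\<And>v. v \<le> w \<Longrightarrow> v \<le> p \<Longrightarrow> v \<le> r"
    and right: "\<And>v. v \<le> w \<Longrightarrow> v \<le> q \<Longrightarrow> v \<le> r"
  shows "w \<le> r"
proof -
  have "(p \<^bold>\<or> q) \<le> (w \<^bold>\<longrightarrow> r)"
    by (rule sup_least) (simp_all add: le_himp_iff left right)
  then have "w \<le> (w \<^bold>\<longrightarrow> r)"
    by (rule order_trans[OF disj])
  then show ?thesis
    by (simp add: le_himp_iff)
qed

text \<open>Case distinction on \<open>p\<close> and, where \<open>p\<close> holds, on
  \<open>q\<close>: a refutation of either conjunct refutes the conjunction.\<close>

lemma decidable_conj:
  fixes w :: "'h::complete_heyting_algebra"
  assumes p: "w \<le> decidable p" and q: "w \<le> decidable q"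
  shows "w \<le> decidable (p \<^bold>\<and> q)"
proof (rule le_hdisjE[OF p[unfolded decidable_def]])
  fix v assume v: "v \<le> w" and vp: "v \<le> p"
  have "v \<le> (q \<^bold>\<or> \<^bold>\<not> q)"
    using order_trans[OF v q] by (simp add: decidable_def)
  then show "v \<le> decidable (p \<^bold>\<and> q)"
  proof (rule le_hdisjE)
    fix u assume "u \<le> v" "u \<le> q"
    then show "u \<le> decidable (p \<^bold>\<and> q)"
      using vp unfolding decidable_def by (intro le_supI1) simp
  next
    fix u assume "u \<le> v" "u \<le> (\<^bold>\<not> q)"
    then show "u \<le> decidable (p \<^bold>\<and> q)"
      unfolding decidable_def by (intro le_supI2) (simp add: le_himp)
  qed
next
  fix v assume "v \<le> w" "v \<le> (\<^bold>\<not> p)"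
  then show "v \<le> decidable (p \<^bold>\<and> q)"
    unfolding decidable_def by (intro le_supI2) (simp add: le_himp)
qed

text \<open>Agreement of \<open>p\<close> and \<open>q\<close> is asked for at every world below
  \<open>w\<close>, because a refutation of \<open>p\<close> at \<open>v\<close> speaks about all
  worlds below \<open>v\<close>.\<close>

lemma decidable_cong:
  fixes w :: "'h::complete_heyting_algebra"
  assumes p: "w \<le> decidable p"
    and eq: "\<And>v. v \<le> w \<Longrightarrow> v \<le> p \<longleftrightarrow> v \<le> q"
  shows "w \<le> decidable q"
proof (rule le_hdisjE[OF p[unfolded decidable_def]])
  fix v assume "v \<le> w" "v \<le> p"
  then show "v \<le> decidable q"
    unfolding decidable_def by (intro le_supI1) (simp add: eq)
next
  fix v assume v: "v \<le> w" "v \<le> (\<^bold>\<not> p)"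
  have "u \<le> bot" if "u \<le> v" "u \<le> q" for u
    using v that eq[of u] unfolding le_himp by (meson order_trans)
  then show "v \<le> decidable q"
    unfolding decidable_def by (intro le_supI2) (simp add: le_himp)
qed

text \<open>Nested internal quantifiers and implications make the world shrink several times in a
  row. By transitivity such successive restrictions amount to a single one; these rules merge them
  in the unfoldings below.\<close>

lemma le_collapse:
  fixes w p :: "'a::order"
  shows "(\<forall>v\<le>w. v \<le> p \<longrightarrow> (\<forall>u\<le>v. Q u)) \<longleftrightarrow> (\<forall>v\<le>w. v \<le> p \<longrightarrow> Q v)"
    and "(\<forall>v\<le>w. v \<le> p \<longrightarrow> (\<forall>x. \<forall>u\<le>v. R x u)) \<longleftrightarrow> (\<forall>x. \<forall>v\<le>w. v \<le> p \<longrightarrow> R x v)"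
    and "(\<forall>v\<le>w. v \<le> p \<longrightarrow> (\<forall>x y. \<forall>u\<le>v. T x y u)) \<longleftrightarrow> (\<forall>x y. \<forall>v\<le>w. v \<le> p \<longrightarrow> T x y v)"
  by (blast intro: order_trans)+

section \<open>Forcing clauses for the order-theoretic notions\<close>

lemma le_Subsets:
  "w \<le> Subsets X S \<longleftrightarrow>
    (\<forall>x. \<forall>v\<le>w. v \<le> S x \<longrightarrow> v \<le> elem X x) \<and>
    (\<forall>x y. \<forall>v\<le>w. v \<le> heq X x y \<longrightarrow> v \<le> S x \<longrightarrow> v \<le> S y)"
  by (auto simp: Subsets_def le_INF_iff le_himp)

lemma le_directed:
  "w \<le> directed D S \<longleftrightarrow>
    w \<le> (\<^bold>\<exists>x. S x) \<and>
    (\<forall>x y. \<forall>v\<le>w. v \<le> S x \<longrightarrow> v \<le> S y \<longrightarrow> v \<le> (\<^bold>\<exists>z\<^bold>\<in>S. hle D x z \<^bold>\<and> hle D y z))"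
  by (simp add: directed_def le_hball le_himp le_collapse)

lemma le_is_sup:
  "w \<le> is_sup D S u \<longleftrightarrow>
    w \<le> elem D u \<and>
    (\<forall>x. \<forall>v\<le>w. v \<le> S x \<longrightarrow> v \<le> hle D x u) \<and>
    (\<forall>y. \<forall>v\<le>w. v \<le> elem D y \<longrightarrow> (\<forall>x. \<forall>t\<le>v. t \<le> S x \<longrightarrow> t \<le> hle D x y) \<longrightarrow> v \<le> hle D u y)"
  by (simp add: is_sup_def le_hball le_himp le_collapse)

lemma le_is_least:
  "w \<le> is_least D u \<longleftrightarrow> w \<le> elem D u \<and> (\<forall>x. \<forall>v\<le>w. v \<le> elem D x \<longrightarrow> v \<le> hle D u x)"
  by (simp add: is_least_def le_hball)

lemma le_way_below:
  "w \<le> way_below D x y \<longleftrightarrow>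
    w \<le> elem D x \<and> w \<le> elem D y \<and>
    (\<forall>S u. \<forall>v\<le>w. v \<le> Subsets D S \<longrightarrow> v \<le> directed D S \<longrightarrow> v \<le> is_sup D S u \<longrightarrow>
      v \<le> hle D y u \<longrightarrow> v \<le> (\<^bold>\<exists>s\<^bold>\<in>S. hle D x s))"
  by (simp add: way_below_def le_hball le_himp le_INF_iff le_collapse)

lemma le_dcpo:
  "w \<le> dcpo D \<longleftrightarrow>
    w \<le> poset D \<and>
    (\<forall>S. \<forall>v\<le>w. v \<le> Subsets D S \<longrightarrow> v \<le> directed D S \<longrightarrow> v \<le> (\<^bold>\<exists>u. is_sup D S u))"
  by (simp add: dcpo_def le_hball le_himp le_collapse)

text \<open>Internally, transitivity and antisymmetry quantify over members of \<open>D\<close>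
  only. Here the membership hypotheses are dropped, since strictness of \<open>hle\<close> recovers
  them from the comparisons.\<close>

lemma le_poset:
  "w \<le> poset D \<longleftrightarrow>
    (\<forall>x y. \<forall>v\<le>w. v \<le> heq D x y \<longrightarrow> v \<le> heq D y x) \<and>
    (\<forall>x y z. \<forall>v\<le>w. v \<le> heq D x y \<longrightarrow> v \<le> heq D y z \<longrightarrow> v \<le> heq D x z) \<and>
    (\<forall>x y. \<forall>v\<le>w. v \<le> hle D x y \<longrightarrow> v \<le> elem D x \<and> v \<le> elem D y) \<and>
    (\<forall>x x' y y'. \<forall>v\<le>w. v \<le> heq D x x' \<longrightarrow> v \<le> heq D y y' \<longrightarrow> v \<le> hle D x y \<longrightarrow> v \<le> hle D x' y') \<and>
    (\<forall>x. \<forall>v\<le>w. v \<le> elem D x \<longrightarrow> v \<le> hle D x x) \<and>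
    (\<forall>x y z. \<forall>v\<le>w. v \<le> hle D x y \<longrightarrow> v \<le> hle D y z \<longrightarrow> v \<le> hle D x z) \<and>
    (\<forall>x y. \<forall>v\<le>w. v \<le> hle D x y \<longrightarrow> v \<le> hle D y x \<longrightarrow> v \<le> heq D x y)"
  (is "_ \<longleftrightarrow> ?sym \<and> ?tr \<and> ?str \<and> ?cong \<and> ?refl \<and> ?trans \<and> ?anti")
proof -
  have e: "v \<le> elem D x \<and> v \<le> elem D y" if ?str "v \<le> w" "v \<le> hle D x y" for v x y
    using that by blast
  have *: "w \<le> (\<^bold>\<forall>x\<^bold>\<in>elem D. \<^bold>\<forall>y\<^bold>\<in>elem D. \<^bold>\<forall>z\<^bold>\<in>elem D. hle D x y \<^bold>\<and> hle D y z \<^bold>\<longrightarrow> hle D x z) \<longleftrightarrow> ?trans"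
    if ?str
    unfolding le_hball le_himp le_inf_iff le_collapse by (intro all_cong1) (metis e[OF that])
  have **: "w \<le> (\<^bold>\<forall>x\<^bold>\<in>elem D. \<^bold>\<forall>y\<^bold>\<in>elem D. hle D x y \<^bold>\<and> hle D y x \<^bold>\<longrightarrow> heq D x y) \<longleftrightarrow> ?anti"
    if ?str
    unfolding le_hball le_himp le_inf_iff le_collapse by (intro all_cong1) (metis e[OF that])
  have sym: "w \<le> (\<^bold>\<forall>x y. heq D x y \<^bold>\<longrightarrow> heq D y x) \<longleftrightarrow> ?sym"
    and tr: "w \<le> (\<^bold>\<forall>x y z. heq D x y \<^bold>\<and> heq D y z \<^bold>\<longrightarrow> heq D x z) \<longleftrightarrow> ?tr"
    and str: "w \<le> (\<^bold>\<forall>x y. hle D x y \<^bold>\<longrightarrow> elem D x \<^bold>\<and> elem D y) \<longleftrightarrow> ?str"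
    and cong: "w \<le> (\<^bold>\<forall>x x' y y'. heq D x x' \<^bold>\<and> heq D y y' \<^bold>\<and> hle D x y \<^bold>\<longrightarrow> hle D x' y') \<longleftrightarrow> ?cong"
    and rfl: "w \<le> (\<^bold>\<forall>x\<^bold>\<in>elem D. hle D x x) \<longleftrightarrow> ?refl"
    by (simp_all add: le_INF_iff le_himp le_hball imp_conjL)
  show ?thesis
  \<comment> \<open>Membership is recovered from a comparison where strictness holds; if strictness
    fails at \<open>w\<close>, both sides are false. The case distinction is on a statement about
    forcing, outside the internal logic.\<close>
  proof (cases ?str)
    case True
    show ?thesis
      unfolding poset_def is_hset_def le_inf_iff sym tr str cong rfl *[OF True] **[OF True]
      unfolding conj_assoc by (rule refl)
  next
    case False
    show ?thesis
      unfolding poset_def le_inf_iff str by (simp only: False simp_thms)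
  qed
qed

text \<open>Each clause of \<open>le_poset\<close> read at the world \<open>w\<close> itself. The
  rules apply at smaller worlds too, since these again force \<open>poset D\<close>.\<close>

lemma
  assumes "w \<le> poset D"
  shows poset_eq_sym: "w \<le> heq D x y \<Longrightarrow> w \<le> heq D y x"
    and poset_eq_trans: "w \<le> heq D x y \<Longrightarrow> w \<le> heq D y z \<Longrightarrow> w \<le> heq D x z"
    and poset_strict: "w \<le> hle D x y \<Longrightarrow> w \<le> elem D x \<and> w \<le> elem D y"
    and poset_cong: "w \<le> heq D x x' \<Longrightarrow> w \<le> heq D y y' \<Longrightarrow> w \<le> hle D x y \<Longrightarrow> w \<le> hle D x' y'"
    and poset_refl: "w \<le> elem D x \<Longrightarrow> w \<le> hle D x x"
    and poset_trans: "w \<le> hle D x y \<Longrightarrow> w \<le> hle D y z \<Longrightarrow> w \<le> hle D x z"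
    and poset_antisym: "w \<le> hle D x y \<Longrightarrow> w \<le> hle D y x \<Longrightarrow> w \<le> heq D x y"
proof -
  note * = assms[unfolded le_poset]
  note ** = *[THEN conjunct2, THEN conjunct2]
  note *** = **[THEN conjunct2, THEN conjunct2]
  show "w \<le> heq D x y \<Longrightarrow> w \<le> heq D y x"
    by (rule *[THEN conjunct1, rule_format, OF order_refl])
  show "w \<le> heq D x y \<Longrightarrow> w \<le> heq D y z \<Longrightarrow> w \<le> heq D x z"
    by (rule *[THEN conjunct2, THEN conjunct1, rule_format, OF order_refl])
  show "w \<le> hle D x y \<Longrightarrow> w \<le> elem D x \<and> w \<le> elem D y"
    by (rule **[THEN conjunct1, rule_format, OF order_refl])
  show "w \<le> heq D x x' \<Longrightarrow> w \<le> heq D y y' \<Longrightarrow> w \<le> hle D x y \<Longrightarrow> w \<le> hle D x' y'"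
    by (rule **[THEN conjunct2, THEN conjunct1, rule_format, OF order_refl])
  show "w \<le> elem D x \<Longrightarrow> w \<le> hle D x x"
    by (rule ***[THEN conjunct1, rule_format, OF order_refl])
  show "w \<le> hle D x y \<Longrightarrow> w \<le> hle D y z \<Longrightarrow> w \<le> hle D x z"
    by (rule ***[THEN conjunct2, THEN conjunct1, rule_format, OF order_refl])
  show "w \<le> hle D x y \<Longrightarrow> w \<le> hle D y x \<Longrightarrow> w \<le> heq D x y"
    by (rule ***[THEN conjunct2, THEN conjunct2, rule_format, OF order_refl])
qed

section \<open>Products of Heyting-valued posets\<close>

lemma heq_prod [simp]: "heq (D \<^bold>\<otimes> E) p q = (heq D (fst p) (fst q) \<^bold>\<and> heq E (snd p) (snd q))"
  and hle_prod [simp]: "hle (D \<^bold>\<otimes> E) p q = (hle D (fst p) (fst q) \<^bold>\<and> hle E (snd p) (snd q))"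
  and elem_prod [simp]: "elem (D \<^bold>\<otimes> E) p = (elem D (fst p) \<^bold>\<and> elem E (snd p))"
  by (simp_all add: prod_ord_def elem_def)

lemma poset_prod:
  assumes "w \<le> poset D" and "w \<le> poset E"
  shows "w \<le> poset (D \<^bold>\<otimes> E)"
  unfolding le_poset
proof (intro conjI allI impI, goal_cases)
  case (1 p q v)
  \<comment> \<open>Both factors are still posets at the smaller world \<open>v\<close>; every case
    starts this way.\<close>
  note * = assms[THEN order_trans[OF 1(1)]]
  from 1 show ?case by (simp add: *[THEN poset_eq_sym])
next
  case (2 p q r v)
  note * = assms[THEN order_trans[OF 2(1)]]
  from 2 show ?case by (auto intro: *[THEN poset_eq_trans])
next
  \<comment> \<open>Strictness concludes with a conjunction and so gives two goals: this one for the
    left argument, the next one for the right.\<close>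
  case (3 p q v)
  note * = assms[THEN order_trans[OF 3(1)]]
  from 3 show ?case by (auto dest: *[THEN poset_strict])
next
  case (4 p q v)
  note * = assms[THEN order_trans[OF 4(1)]]
  from 4 show ?case by (auto dest: *[THEN poset_strict])
next
  case (5 p p' q q' v)
  note * = assms[THEN order_trans[OF 5(1)]]
  from 5 show ?case by (auto intro: *[THEN poset_cong])
next
  case (6 p v)
  note * = assms[THEN order_trans[OF 6(1)]]
  from 6 show ?case by (simp add: *[THEN poset_refl])
next
  case (7 p q r v)
  note * = assms[THEN order_trans[OF 7(1)]]
  from 7 show ?case by (auto intro: *[THEN poset_trans])
next
  case (8 p q v)
  note * = assms[THEN order_trans[OF 8(1)]]
  from 8 show ?case by (simp add: *[THEN poset_antisym])
qed

lemma Subsets_prod: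
  assumes "w \<le> Subsets D A" and "w \<le> Subsets E B"
  shows "w \<le> Subsets (D \<^bold>\<otimes> E) (A \<^bold>\<times> B)"
  using assms unfolding le_Subsets prod_sub_def by (simp, blast)

lemma directed_prod:
  assumes A: "w \<le> directed D A" and B: "w \<le> directed E B"
  shows "w \<le> directed (D \<^bold>\<otimes> E) (A \<^bold>\<times> B)"
  unfolding le_directed
proof (intro conjI allI impI)
  have "w \<le> (\<^bold>\<exists>x. A x)" "w \<le> (\<^bold>\<exists>y. B y)"
    using A B by (auto simp: le_directed)
  then show "w \<le> (\<^bold>\<exists>p. (A \<^bold>\<times> B) p)"
  proof (elim le_hexE)
    fix x v assume v: "v \<le> w" "v \<le> A x" and "w \<le> (\<^bold>\<exists>y. B y)"
    \<comment> \<open>The witness \<open>x\<close> is available at \<open>v\<close>, so the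
      inhabitedness of \<open>B\<close> is restricted to \<open>v\<close> before a second witness is
      taken.\<close>
    then have "v \<le> (\<^bold>\<exists>y. B y)" by (meson order_trans)
    then show "v \<le> (\<^bold>\<exists>p. (A \<^bold>\<times> B) p)"
    proof (rule le_hexE)
      fix y t assume "t \<le> v" "t \<le> B y"
      with v show "t \<le> (\<^bold>\<exists>p. (A \<^bold>\<times> B) p)"
        by (intro le_hexI[of _ _ "(x, y)"]) (auto simp: prod_sub_def)
    qed
  qed
next
  fix p q v assume v: "v \<le> w" and pq: "v \<le> (A \<^bold>\<times> B) p" "v \<le> (A \<^bold>\<times> B) q"
  have a: "v \<le> (\<^bold>\<exists>z\<^bold>\<in>A. hle D (fst p) z \<^bold>\<and> hle D (fst q) z)"
    and b: "v \<le> (\<^bold>\<exists>z\<^bold>\<in>B. hle E (snd p) z \<^bold>\<and> hle E (snd q) z)"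
    using A B v pq by (auto simp: le_directed prod_sub_def)
  from a show "v \<le> (\<^bold>\<exists>z\<^bold>\<in>A \<^bold>\<times> B. hle (D \<^bold>\<otimes> E) p z \<^bold>\<and> hle (D \<^bold>\<otimes> E) q z)"
  proof (rule le_hbexE)
    fix x u assume u: "u \<le> v" and x: "u \<le> A x" "u \<le> (hle D (fst p) x \<^bold>\<and> hle D (fst q) x)"
    from order_trans[OF u b] show "u \<le> (\<^bold>\<exists>z\<^bold>\<in>A \<^bold>\<times> B. hle (D \<^bold>\<otimes> E) p z \<^bold>\<and> hle (D \<^bold>\<otimes> E) q z)"
    proof (rule le_hbexE)
      fix y t assume "t \<le> u" "t \<le> B y" "t \<le> (hle E (snd p) y \<^bold>\<and> hle E (snd q) y)"
      with x show "t \<le> (\<^bold>\<exists>z\<^bold>\<in>A \<^bold>\<times> B. hle (D \<^bold>\<otimes> E) p z \<^bold>\<and> hle (D \<^bold>\<otimes> E) q z)"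
        by (intro le_hbexI[of _ _ "(x, y)"]) (auto simp: prod_sub_def)
    qed
  qed
qed

text \<open>Inhabitedness of both sets enters in the leastness: an upper bound of the product bounds
  \<open>A\<close> in its first component because each \<open>x\<close> in \<open>A\<close> can be
  paired with some \<open>y\<close> in \<open>B\<close>, and symmetrically for
  \<open>B\<close>.\<close>

lemma is_sup_prod:
  assumes A: "w \<le> (\<^bold>\<exists>x. A x)" and B: "w \<le> (\<^bold>\<exists>y. B y)"
    and a: "w \<le> is_sup D A a" and b: "w \<le> is_sup E B b"
  shows "w \<le> is_sup (D \<^bold>\<otimes> E) (A \<^bold>\<times> B) (a, b)"
  unfolding le_is_sup
proof (intro conjI allI impI)
  show "w \<le> elem (D \<^bold>\<otimes> E) (a, b)"
    using a b by (simp add: le_is_sup)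
next
  fix p v assume "v \<le> w" "v \<le> (A \<^bold>\<times> B) p"
  then show "v \<le> hle (D \<^bold>\<otimes> E) p (a, b)"
    using a b by (simp add: le_is_sup prod_sub_def)
next
  fix q v assume v: "v \<le> w" "v \<le> elem (D \<^bold>\<otimes> E) q"
    and ub: "\<forall>p. \<forall>t\<le>v. t \<le> (A \<^bold>\<times> B) p \<longrightarrow> t \<le> hle (D \<^bold>\<otimes> E) p q"
  have "v \<le> hle D a (fst q)"
  proof (rule le_hexE[OF order_trans[OF v(1) B]])
    fix y u assume u: "u \<le> v" "u \<le> B y"
    have "t \<le> hle D x (fst q)" if "t \<le> u" "t \<le> A x" for x t
    proof -
      have "t \<le> v" "t \<le> (A \<^bold>\<times> B) (x, y)"
        using that u by (auto simp: prod_sub_def)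
      then show ?thesis using ub by fastforce
    qed
    moreover have "u \<le> w" "u \<le> elem D (fst q)"
      using u v by auto
    ultimately show "u \<le> hle D a (fst q)"
      using a unfolding le_is_sup by blast
  qed
  moreover have "v \<le> hle E b (snd q)"
  proof (rule le_hexE[OF order_trans[OF v(1) A]])
    fix x u assume u: "u \<le> v" "u \<le> A x"
    have "t \<le> hle E y (snd q)" if "t \<le> u" "t \<le> B y" for y t
    proof -
      have "t \<le> v" "t \<le> (A \<^bold>\<times> B) (x, y)"
        using that u by (auto simp: prod_sub_def)
      then show ?thesis using ub by fastforce
    qed
    moreover have "u \<le> w" "u \<le> elem E (snd q)"
      using u v by auto
    ultimately show "u \<le> hle E b (snd q)"
      using b unfolding le_is_sup by blast
  qed
  ultimately show "v \<le> hle (D \<^bold>\<otimes> E) (a, b) q"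
    by simp
qed

section \<open>Projections of directed subsets of a product\<close>

text \<open>The image of \<open>S\<close> under the first projection. For a subset \<open>S\<close>
  of the product, extensionality makes this equivalent to asking for some \<open>p\<close> in
  \<open>S\<close> whose first component is equal to \<open>x\<close> in the sense of
  \<open>heq\<close>.\<close>

abbreviation hdom :: "('a \<times> 'b \<Rightarrow> 'h) \<Rightarrow> 'a \<Rightarrow> 'h::complete_heyting_algebra"
  where "hdom S \<equiv> (\<lambda>x. \<^bold>\<exists>y. S (x, y))"

abbreviation hran :: "('a \<times> 'b \<Rightarrow> 'h) \<Rightarrow> 'b \<Rightarrow> 'h::complete_heyting_algebra"
  where "hran S \<equiv> (\<lambda>y. \<^bold>\<exists>x. S (x, y))"

lemma Subsets_hdom:
  assumes S: "w \<le> Subsets (D \<^bold>\<otimes> E) S"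
  shows "w \<le> Subsets D (hdom S)"
  unfolding le_Subsets
proof (intro conjI allI impI)
  fix x v assume v: "v \<le> w" and "v \<le> hdom S x"
  from this(2) show "v \<le> elem D x"
  proof (rule le_hexE)
    fix y u assume "u \<le> v" "u \<le> S (x, y)"
    then have "u \<le> elem (D \<^bold>\<otimes> E) (x, y)"
      using S v unfolding le_Subsets by (meson order_trans)
    then show "u \<le> elem D x" by simp
  qed
next
  fix x x' v assume v: "v \<le> w" "v \<le> heq D x x'" and "v \<le> hdom S x"
  from this(3) show "v \<le> hdom S x'"
  proof (rule le_hexE)
    fix y u assume u: "u \<le> v" "u \<le> S (x, y)"
    then have "u \<le> w" using v by simp
    \<comment> \<open>Moving from \<open>(x, y)\<close> to \<open>(x', y)\<close> inside
      \<open>S\<close> requires \<open>y = y\<close>, that is, membership of \<open>y\<close> in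
      \<open>E\<close>; this holds because \<open>(x, y)\<close> belongs to the product.\<close>
    then have "u \<le> elem E y"
      using S u unfolding le_Subsets by fastforce
    then have "u \<le> heq (D \<^bold>\<otimes> E) (x, y) (x', y)"
      using u v by (simp add: elem_def)
    then have "u \<le> S (x', y)"
      using S \<open>u \<le> w\<close> u unfolding le_Subsets by blast
    then show "u \<le> hdom S x'"
      by (rule le_hexI)
  qed
qed

lemma directed_hdom:
  assumes S: "w \<le> directed (D \<^bold>\<otimes> E) S"
  shows "w \<le> directed D (hdom S)"
  unfolding le_directed
proof (intro conjI allI impI)
  have "w \<le> (\<^bold>\<exists>p. S p)"
    using S by (simp add: le_directed)
  then show "w \<le> (\<^bold>\<exists>x. hdom S x)"
  proof (rule le_hexE)
    fix p v assume "v \<le> S p"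
    then show "v \<le> (\<^bold>\<exists>x. hdom S x)"
      by (intro le_hexI[of _ _ "fst p"] le_hexI[of _ _ "snd p"]) simp
  qed
next
  fix x x' v assume v: "v \<le> w" and x: "v \<le> hdom S x" and x': "v \<le> hdom S x'"
  let ?G = "\<^bold>\<exists>z\<^bold>\<in>hdom S. hle D x z \<^bold>\<and> hle D x' z"
  from x show "v \<le> ?G"
  proof (rule le_hexE)
    fix y u assume u: "u \<le> v" "u \<le> S (x, y)"
    from order_trans[OF u(1) x'] show "u \<le> ?G"
    proof (rule le_hexE)
      fix y' t assume t: "t \<le> u" "t \<le> S (x', y')"
      then have "t \<le> w" "t \<le> S (x, y)"
        using u v by auto
      then have "t \<le> (\<^bold>\<exists>z\<^bold>\<in>S. hle (D \<^bold>\<otimes> E) (x, y) z \<^bold>\<and> hle (D \<^bold>\<otimes> E) (x', y') z)"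
        using S t unfolding le_directed by blast
      then show "t \<le> ?G"
      proof (rule le_hbexE)
        fix z s
        assume "s \<le> S z" "s \<le> (hle (D \<^bold>\<otimes> E) (x, y) z \<^bold>\<and> hle (D \<^bold>\<otimes> E) (x', y') z)"
        then show "s \<le> ?G"
          by (intro le_hbexI[of _ _ "fst z"] le_hexI[of _ _ "snd z"]) auto
      qed
    qed
  qed
qed

lemma is_sup_hdom:
  assumes E: "w \<le> poset E"
    and u: "w \<le> is_sup (D \<^bold>\<otimes> E) S (a, b)"
  shows "w \<le> is_sup D (hdom S) a"
  unfolding le_is_sup
proof (intro conjI allI impI)
  show "w \<le> elem D a"
    using u by (simp add: le_is_sup)
next
  fix x v assume v: "v \<le> w" and "v \<le> hdom S x"
  from this(2) show "v \<le> hle D x a"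
  proof (rule le_hexE)
    fix y t assume "t \<le> v" "t \<le> S (x, y)"
    with v u have "t \<le> hle (D \<^bold>\<otimes> E) (x, y) (a, b)"
      unfolding le_is_sup by (meson order_trans)
    then show "t \<le> hle D x a" by simp
  qed
next
  fix c v assume v: "v \<le> w" "v \<le> elem D c"
    and ub: "\<forall>x. \<forall>t\<le>v. t \<le> hdom S x \<longrightarrow> t \<le> hle D x c"
  \<comment> \<open>An upper bound \<open>c\<close> of the projection is completed by
    \<open>b\<close>, which already bounds all second components. The pair \<open>(c, b)\<close>
    then bounds \<open>S\<close>, and leastness of \<open>(a, b)\<close> gives
    \<open>a \<sqsubseteq> c\<close>.\<close>
  have "t \<le> hle (D \<^bold>\<otimes> E) p (c, b)" if "t \<le> v" "t \<le> S p" for p t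
  proof -
    have "t \<le> hdom S (fst p)"
      using that by (intro le_hexI[of _ _ "snd p"]) simp
    then have "t \<le> hle D (fst p) c"
      using ub that by blast
    moreover have "t \<le> hle (D \<^bold>\<otimes> E) p (a, b)"
      using u that v unfolding le_is_sup by (meson order_trans)
    ultimately show ?thesis by simp
  qed
  moreover have "v \<le> elem (D \<^bold>\<otimes> E) (c, b)"
    using u v by (auto simp: le_is_sup)
  ultimately have "v \<le> hle (D \<^bold>\<otimes> E) (a, b) (c, b)"
    using u v(1) unfolding le_is_sup by blast
  then show "v \<le> hle D a c" by simp
qed

section \<open>Exchange of the two factors, and the second projection\<close>

lemma Subsets_swap:
  assumes "w \<le> Subsets (D \<^bold>\<otimes> E) S"
  shows "w \<le> Subsets (E \<^bold>\<otimes> D) (S \<circ> prod.swap)"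
  using assms unfolding le_Subsets by (simp, blast)

lemma directed_swap:
  assumes S: "w \<le> directed (D \<^bold>\<otimes> E) S"
  shows "w \<le> directed (E \<^bold>\<otimes> D) (S \<circ> prod.swap)"
  unfolding le_directed
proof (intro conjI allI impI)
  have "w \<le> (\<^bold>\<exists>p. S p)"
    using S by (simp add: le_directed)
  then show "w \<le> (\<^bold>\<exists>p. (S \<circ> prod.swap) p)"
  proof (rule le_hexE)
    fix p v assume "v \<le> S p"
    then show "v \<le> (\<^bold>\<exists>p. (S \<circ> prod.swap) p)"
      by (intro le_hexI[of _ _ "prod.swap p"]) simp
  qed
next
  fix p q v assume "v \<le> w" "v \<le> (S \<circ> prod.swap) p" "v \<le> (S \<circ> prod.swap) q"
  then have "v \<le> (\<^bold>\<exists>z\<^bold>\<in>S. hle (D \<^bold>\<otimes> E) (prod.swap p) z \<^bold>\<and> hle (D \<^bold>\<otimes> E) (prod.swap q) z)"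
    using S unfolding le_directed comp_def by blast
  then show "v \<le> (\<^bold>\<exists>z\<^bold>\<in>S \<circ> prod.swap. hle (E \<^bold>\<otimes> D) p z \<^bold>\<and> hle (E \<^bold>\<otimes> D) q z)"
  proof (rule le_hbexE)
    fix z t
    assume "t \<le> S z" "t \<le> (hle (D \<^bold>\<otimes> E) (prod.swap p) z \<^bold>\<and> hle (D \<^bold>\<otimes> E) (prod.swap q) z)"
    then show "t \<le> (\<^bold>\<exists>z\<^bold>\<in>S \<circ> prod.swap. hle (E \<^bold>\<otimes> D) p z \<^bold>\<and> hle (E \<^bold>\<otimes> D) q z)"
      by (intro le_hbexI[of _ _ "prod.swap z"]) auto
  qed
qed

lemma is_sup_swap:
  assumes "w \<le> is_sup (D \<^bold>\<otimes> E) S (a, b)"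
  shows "w \<le> is_sup (E \<^bold>\<otimes> D) (S \<circ> prod.swap) (b, a)"
  using assms unfolding le_is_sup by (simp, blast)

lemma Subsets_hran:
  assumes "w \<le> Subsets (D \<^bold>\<otimes> E) S"
  shows "w \<le> Subsets E (hran S)"
  \<comment> \<open>The first projection of the swapped set is \<open>hran S\<close>.\<close>
  using Subsets_hdom[OF Subsets_swap[OF assms]] by simp

lemma directed_hran:
  assumes "w \<le> directed (D \<^bold>\<otimes> E) S"
  shows "w \<le> directed E (hran S)"
  using directed_hdom[OF directed_swap[OF assms]] by simp

lemma is_sup_hran:
  assumes "w \<le> poset D" and "w \<le> is_sup (D \<^bold>\<otimes> E) S (a, b)"
  shows "w \<le> is_sup E (hran S) b"
  using is_sup_hdom[OF assms(1) is_sup_swap[OF assms(2)]] by simp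

text \<open>An upper bound of \<open>S\<close> bounds each projection in the corresponding
  component, hence lies above both suprema. This supplies the suprema that make the product a
  dcpo.\<close>

lemma is_sup_of_projections:
  assumes S: "w \<le> Subsets (D \<^bold>\<otimes> E) S"
    and a: "w \<le> is_sup D (hdom S) a" and b: "w \<le> is_sup E (hran S) b"
  shows "w \<le> is_sup (D \<^bold>\<otimes> E) S (a, b)"
  unfolding le_is_sup
proof (intro conjI allI impI)
  show "w \<le> elem (D \<^bold>\<otimes> E) (a, b)"
    using a b by (simp add: le_is_sup)
next
  fix p v assume v: "v \<le> w" "v \<le> S p"
  have "v \<le> hdom S (fst p)" "v \<le> hran S (snd p)"
    using v(2) by (auto intro: le_hexI[of _ _ "snd p"] le_hexI[of _ _ "fst p"])
  then show "v \<le> hle (D \<^bold>\<otimes> E) p (a, b)"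
    using a b v(1) unfolding le_is_sup by simp
next
  fix q v assume v: "v \<le> w" "v \<le> elem (D \<^bold>\<otimes> E) q"
    and ub: "\<forall>p. \<forall>t\<le>v. t \<le> S p \<longrightarrow> t \<le> hle (D \<^bold>\<otimes> E) p q"
  have "t \<le> hle D x (fst q)" if "t \<le> v" "t \<le> hdom S x" for x t
    using that(2)
  proof (rule le_hexE)
    fix y s assume "s \<le> t" "s \<le> S (x, y)"
    with ub that(1) have "s \<le> hle (D \<^bold>\<otimes> E) (x, y) q"
      by (meson order_trans)
    then show "s \<le> hle D x (fst q)" by simp
  qed
  then have 1: "v \<le> hle D a (fst q)"
    using a v unfolding le_is_sup by simp
  have "t \<le> hle E y (snd q)" if "t \<le> v" "t \<le> hran S y" for y t
    using that(2)
  proof (rule le_hexE)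
    fix x s assume "s \<le> t" "s \<le> S (x, y)"
    with ub that(1) have "s \<le> hle (D \<^bold>\<otimes> E) (x, y) q"
      by (meson order_trans)
    then show "s \<le> hle E y (snd q)" by simp
  qed
  then have "v \<le> hle E b (snd q)"
    using b v unfolding le_is_sup by simp
  with 1 show "v \<le> hle (D \<^bold>\<otimes> E) (a, b) q"
    by simp
qed

lemma dcpo_prod:
  assumes D: "w \<le> dcpo D" and E: "w \<le> dcpo E"
  shows "w \<le> dcpo (D \<^bold>\<otimes> E)"
  unfolding le_dcpo
proof (intro conjI allI impI)
  show "w \<le> poset (D \<^bold>\<otimes> E)"
    using D E by (simp add: le_dcpo poset_prod)
next
  fix S v assume v: "v \<le> w" and S: "v \<le> Subsets (D \<^bold>\<otimes> E) S" "v \<le> directed (D \<^bold>\<otimes> E) S"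
  have a: "v \<le> (\<^bold>\<exists>a. is_sup D (hdom S) a)"
    using D v Subsets_hdom[OF S(1)] directed_hdom[OF S(2)] by (simp add: le_dcpo)
  have b: "v \<le> (\<^bold>\<exists>b. is_sup E (hran S) b)"
    using E v Subsets_hran[OF S(1)] directed_hran[OF S(2)] by (simp add: le_dcpo)
  from a show "v \<le> (\<^bold>\<exists>p. is_sup (D \<^bold>\<otimes> E) S p)"
  proof (rule le_hexE)
    fix a u assume u: "u \<le> v" "u \<le> is_sup D (hdom S) a"
    from order_trans[OF u(1) b] show "u \<le> (\<^bold>\<exists>p. is_sup (D \<^bold>\<otimes> E) S p)"
    proof (rule le_hexE)
      \<comment> \<open>The two suprema are obtained locally, the first at \<open>u\<close> and the
        second at the smaller world \<open>t\<close>, so the pair is formed at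
        \<open>t\<close>.\<close>
      fix b t assume t: "t \<le> u" "t \<le> is_sup E (hran S) b"
      have "t \<le> Subsets (D \<^bold>\<otimes> E) S" "t \<le> is_sup D (hdom S) a"
        using t(1) u S(1) by (blast intro: order_trans)+
      then show "t \<le> (\<^bold>\<exists>p. is_sup (D \<^bold>\<otimes> E) S p)"
        using t(2) by (intro le_hexI[of _ _ "(a, b)"] is_sup_of_projections)
    qed
  qed
qed

section \<open>The way-below relation of a product\<close>

text \<open>\<open>heq D d\<close> is the singleton subset \<open>{d}\<close>.\<close>

lemma Subsets_heq:
  assumes D: "w \<le> poset D"
  shows "w \<le> Subsets D (heq D d)"
  unfolding le_Subsets
proof (intro conjI allI impI)
  fix x v assume "v \<le> w" and x: "v \<le> heq D d x"
  note D' = order_trans[OF this(1) D]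
  show "v \<le> elem D x"
    unfolding elem_def by (rule poset_eq_trans[OF D' poset_eq_sym[OF D' x] x])
next
  fix x y v assume "v \<le> w" and "v \<le> heq D x y" "v \<le> heq D d x"
  then show "v \<le> heq D d y"
    by (blast intro: order_trans[OF _ D] poset_eq_trans)
qed

lemma directed_heq:
  assumes D: "w \<le> poset D" and d: "w \<le> elem D d"
  shows "w \<le> directed D (heq D d)"
  unfolding le_directed
proof (intro conjI allI impI)
  show "w \<le> (\<^bold>\<exists>x. heq D d x)"
    using d by (intro le_hexI[of _ _ d]) (simp add: elem_def)
next
  fix x y v assume v: "v \<le> w" "v \<le> heq D d x" "v \<le> heq D d y"
  then have "v \<le> elem D d" using d by simp
  then have "v \<le> heq D d d" "v \<le> hle D d d"
    using D v unfolding le_poset elem_def by blast+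
  \<comment> \<open>Reflexivity at \<open>d\<close> is transported along \<open>d = x\<close> and
    \<open>d = y\<close>.\<close>
  with v have "v \<le> hle D x d" "v \<le> hle D y d"
    using D unfolding le_poset by blast+
  with \<open>v \<le> heq D d d\<close> show "v \<le> (\<^bold>\<exists>z\<^bold>\<in>heq D d. hle D x z \<^bold>\<and> hle D y z)"
    by (intro le_hbexI[of _ _ d]) auto
qed

lemma is_sup_heq:
  assumes D: "w \<le> poset D" and d: "w \<le> elem D d"
  shows "w \<le> is_sup D (heq D d) d"
  unfolding le_is_sup
proof (intro conjI allI impI)
  show "w \<le> elem D d" by (rule d)
next
  fix x v assume v: "v \<le> w" "v \<le> heq D d x"
  then have "v \<le> elem D d" using d by simp
  then have "v \<le> heq D d d" "v \<le> hle D d d"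
    using D v unfolding le_poset elem_def by blast+
  with v show "v \<le> hle D x d"
    using D unfolding le_poset by blast
next
  fix y v assume "v \<le> w" and ub: "\<forall>x. \<forall>t\<le>v. t \<le> heq D d x \<longrightarrow> t \<le> hle D x y"
  then have "v \<le> heq D d d" using d by (simp add: elem_def)
  then show "v \<le> hle D d y" using ub by blast
qed

text \<open>If \<open>S\<close> has a supremum \<open>u\<close> above \<open>c\<close>, then
  \<open>S \<times> {d}\<close> has the supremum \<open>(u, d)\<close> above \<open>(c, d)\<close>.
  A member of it above \<open>(a, b)\<close> has its first component in \<open>S\<close> and above
  \<open>a\<close>.\<close>

lemma way_below_fst:
  assumes D: "w \<le> poset D" and E: "w \<le> poset E"
    and ab: "w \<le> way_below (D \<^bold>\<otimes> E) (a, b) (c, d)"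
  shows "w \<le> way_below D a c"
  unfolding le_way_below
proof (intro conjI allI impI)
  show "w \<le> elem D a" "w \<le> elem D c"
    using ab by (auto simp: le_way_below)
next
  fix S u v
  assume v: "v \<le> w" and S: "v \<le> Subsets D S" "v \<le> directed D S" "v \<le> is_sup D S u"
    and cu: "v \<le> hle D c u"
  have E': "v \<le> poset E" using v E by (rule order_trans)
  have d: "v \<le> elem E d" using v ab by (auto simp: le_way_below)
  have "v \<le> hle E d d" using E' d unfolding le_poset by blast
  then have "v \<le> hle (D \<^bold>\<otimes> E) (c, d) (u, d)" using cu by simp
  moreover have "v \<le> Subsets (D \<^bold>\<otimes> E) (S \<^bold>\<times> heq E d)"
    by (intro Subsets_prod Subsets_heq S E')
  moreover have "v \<le> directed (D \<^bold>\<otimes> E) (S \<^bold>\<times> heq E d)"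
    by (intro directed_prod directed_heq S E' d)
  \<comment> \<open>The inhabitants that \<open>is_sup_prod\<close> asks for come from the
    directedness of the two factors.\<close>
  moreover have "v \<le> is_sup (D \<^bold>\<otimes> E) (S \<^bold>\<times> heq E d) (u, d)"
    using S directed_heq[OF E' d] by (intro is_sup_prod is_sup_heq E' d) (auto simp: le_directed)
  ultimately have "v \<le> (\<^bold>\<exists>s\<^bold>\<in>S \<^bold>\<times> heq E d. hle (D \<^bold>\<otimes> E) (a, b) s)"
    using ab v unfolding le_way_below by blast
  then show "v \<le> (\<^bold>\<exists>s\<^bold>\<in>S. hle D a s)"
  proof (rule le_hbexE)
    fix p t assume "t \<le> (S \<^bold>\<times> heq E d) p" "t \<le> hle (D \<^bold>\<otimes> E) (a, b) p"
    then show "t \<le> (\<^bold>\<exists>s\<^bold>\<in>S. hle D a s)"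
      by (intro le_hbexI[of _ _ "fst p"]) (auto simp: prod_sub_def)
  qed
qed

text \<open>Swapping the test set, its supremum and the witness turns a test in one product into a
  test in the other. Combined with \<open>way_below_fst\<close> this handles the second
  component.\<close>

lemma way_below_swap:
  assumes ab: "w \<le> way_below (D \<^bold>\<otimes> E) (a, b) (c, d)"
  shows "w \<le> way_below (E \<^bold>\<otimes> D) (b, a) (d, c)"
  unfolding le_way_below
proof (intro conjI allI impI)
  show "w \<le> elem (E \<^bold>\<otimes> D) (b, a)" "w \<le> elem (E \<^bold>\<otimes> D) (d, c)"
    using ab by (auto simp: le_way_below)
next
  fix S u v
  assume v: "v \<le> w" and S: "v \<le> Subsets (E \<^bold>\<otimes> D) S" "v \<le> directed (E \<^bold>\<otimes> D) S"
      "v \<le> is_sup (E \<^bold>\<otimes> D) S u"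
    and le: "v \<le> hle (E \<^bold>\<otimes> D) (d, c) u"
  have "v \<le> is_sup (D \<^bold>\<otimes> E) (S \<circ> prod.swap) (prod.swap u)"
    using S(3) is_sup_swap[of v E D S "fst u" "snd u"] by (simp add: prod.swap_def)
  moreover have "v \<le> hle (D \<^bold>\<otimes> E) (c, d) (prod.swap u)"
    using le by simp
  ultimately have "v \<le> (\<^bold>\<exists>s\<^bold>\<in>S \<circ> prod.swap. hle (D \<^bold>\<otimes> E) (a, b) s)"
    using ab v Subsets_swap[OF S(1)] directed_swap[OF S(2)] unfolding le_way_below by blast
  then show "v \<le> (\<^bold>\<exists>s\<^bold>\<in>S. hle (E \<^bold>\<otimes> D) (b, a) s)"
  proof (rule le_hbexE)
    fix p t assume "t \<le> (S \<circ> prod.swap) p" "t \<le> hle (D \<^bold>\<otimes> E) (a, b) p"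
    then show "t \<le> (\<^bold>\<exists>s\<^bold>\<in>S. hle (E \<^bold>\<otimes> D) (b, a) s)"
      by (intro le_hbexI[of _ _ "prod.swap p"]) auto
  qed
qed

text \<open>Testing the projections of \<open>S\<close> gives two members of \<open>S\<close> that
  may differ: \<open>p\<close> with \<open>a\<close> below its first component and \<open>q\<close>
  with \<open>b\<close> below its second. An upper bound of \<open>p\<close> and \<open>q\<close> in
  \<open>S\<close> lies above \<open>(a, b)\<close>.\<close>

lemma way_below_pair:
  assumes D: "w \<le> poset D" and E: "w \<le> poset E"
    and a: "w \<le> way_below D a c" and b: "w \<le> way_below E b d"
  shows "w \<le> way_below (D \<^bold>\<otimes> E) (a, b) (c, d)"
  unfolding le_way_below
proof (intro conjI allI impI)
  show "w \<le> elem (D \<^bold>\<otimes> E) (a, b)" "w \<le> elem (D \<^bold>\<otimes> E) (c, d)"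
    using a b by (auto simp: le_way_below)
next
  fix S u v
  assume v: "v \<le> w" and S: "v \<le> Subsets (D \<^bold>\<otimes> E) S" "v \<le> directed (D \<^bold>\<otimes> E) S"
      "v \<le> is_sup (D \<^bold>\<otimes> E) S u"
    and le: "v \<le> hle (D \<^bold>\<otimes> E) (c, d) u"
  let ?G = "\<^bold>\<exists>s\<^bold>\<in>S. hle (D \<^bold>\<otimes> E) (a, b) s"
  note D' = order_trans[OF v D] and E' = order_trans[OF v E]
  have u: "v \<le> is_sup (D \<^bold>\<otimes> E) S (fst u, snd u)"
    using S(3) by simp
  have "v \<le> hle D c (fst u)" "v \<le> hle E d (snd u)"
    using le by auto
  then have ex1: "v \<le> (\<^bold>\<exists>x\<^bold>\<in>hdom S. hle D a x)" and ex2: "v \<le> (\<^bold>\<exists>y\<^bold>\<in>hran S. hle E b y)"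
    using a b v Subsets_hdom[OF S(1)] directed_hdom[OF S(2)] is_sup_hdom[OF E' u]
      Subsets_hran[OF S(1)] directed_hran[OF S(2)] is_sup_hran[OF D' u]
    unfolding le_way_below by blast+
  \<comment> \<open>An element of the projection is the first component of some pair in
    \<open>S\<close>; from here on the whole pair is kept, so that directedness of \<open>S\<close>
    can be applied to it.\<close>
  from ex1 have "v \<le> (\<^bold>\<exists>p\<^bold>\<in>S. hle D a (fst p))"
  proof (elim le_hbexE le_hexE)
    fix x t y s
    assume "t \<le> hle D a x" "s \<le> t" "s \<le> S (x, y)"
    then show "s \<le> (\<^bold>\<exists>p\<^bold>\<in>S. hle D a (fst p))"
      by (intro le_hbexI[of _ _ "(x, y)"]) auto
  qed
  then show "v \<le> ?G"
  proof (rule le_hbexE)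
    fix p t assume t: "t \<le> v" "t \<le> S p" "t \<le> hle D a (fst p)"
    from order_trans[OF t(1) ex2] have "t \<le> (\<^bold>\<exists>q\<^bold>\<in>S. hle E b (snd q))"
    proof (elim le_hbexE le_hexE)
      fix y r x s
      assume "r \<le> hle E b y" "s \<le> r" "s \<le> S (x, y)"
      then show "s \<le> (\<^bold>\<exists>q\<^bold>\<in>S. hle E b (snd q))"
        by (intro le_hbexI[of _ _ "(x, y)"]) auto
    qed
    then show "t \<le> ?G"
    proof (rule le_hbexE)
      fix q s assume s: "s \<le> t" "s \<le> S q" "s \<le> hle E b (snd q)"
      have "s \<le> v" "s \<le> S p"
        using s(1) t by auto
      \<comment> \<open>Directedness of \<open>S\<close> merges \<open>p\<close> and
        \<open>q\<close> into the single element \<open>z\<close>.\<close>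
      then have "s \<le> (\<^bold>\<exists>z\<^bold>\<in>S. hle (D \<^bold>\<otimes> E) p z \<^bold>\<and> hle (D \<^bold>\<otimes> E) q z)"
        using S(2) s(2) unfolding le_directed by blast
      then show "s \<le> ?G"
      proof (rule le_hbexE)
        fix z r assume r: "r \<le> s" "r \<le> S z" "r \<le> (hle (D \<^bold>\<otimes> E) p z \<^bold>\<and> hle (D \<^bold>\<otimes> E) q z)"
        have "r \<le> poset D" "r \<le> poset E" "r \<le> hle D a (fst p)" "r \<le> hle E b (snd q)"
          using D' E' r(1) s t by auto
        moreover have "r \<le> hle D (fst p) (fst z)" "r \<le> hle E (snd q) (snd z)"
          using r(3) by auto
        ultimately have "r \<le> hle D a (fst z)" "r \<le> hle E b (snd z)"
          by (blast intro: poset_trans)+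
        then show "r \<le> ?G"
          using r(2) by (intro le_hbexI[of _ _ z]) auto
      qed
    qed
  qed
qed

text \<open>Stated as an equivalence of forcing at \<open>w\<close>, not as an equation between
  truth values, because the hypotheses that \<open>D\<close> and \<open>E\<close> are posets are
  themselves only forced at \<open>w\<close>.\<close>

lemma way_below_prod:
  assumes D: "w \<le> poset D" and E: "w \<le> poset E"
  shows "w \<le> way_below (D \<^bold>\<otimes> E) p q \<longleftrightarrow>
    w \<le> way_below D (fst p) (fst q) \<and> w \<le> way_below E (snd p) (snd q)"
  using way_below_pair[OF D E, of "fst p" "fst q" "snd p" "snd q"]
    way_below_fst[OF D E, of "fst p" "snd p" "fst q" "snd q"]
    way_below_fst[OF E D, of "snd p" "fst p" "snd q" "fst q"]
    way_below_swap[of w D E "fst p" "snd p" "fst q" "snd q"]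
  by auto

section \<open>Bases and decidability\<close>

text \<open>Replaces a set by one that agrees with it below \<open>w\<close>. The basis elements way
  below a point of the product are identified with a product of two sets only below a world forcing
  that \<open>D\<close> and \<open>E\<close> are posets.\<close>

lemma directed_cong:
  assumes "\<And>v x. v \<le> w \<Longrightarrow> v \<le> S x \<longleftrightarrow> v \<le> T x" and "w \<le> directed D S"
  shows "w \<le> directed D T"
  unfolding le_directed
proof (intro conjI allI impI)
  have "w \<le> (\<^bold>\<exists>x. S x)"
    using assms(2) by (simp add: le_directed)
  then show "w \<le> (\<^bold>\<exists>x. T x)"
    by (rule le_hexE) (metis assms(1) le_hexI)
next
  fix x y v assume v: "v \<le> w" "v \<le> T x" "v \<le> T y"
  then have "v \<le> (\<^bold>\<exists>z\<^bold>\<in>S. hle D x z \<^bold>\<and> hle D y z)"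
    using assms unfolding le_directed by blast
  then show "v \<le> (\<^bold>\<exists>z\<^bold>\<in>T. hle D x z \<^bold>\<and> hle D y z)"
    by (rule le_hbexE) (metis assms(1) le_hbexI order_trans v(1))
qed

lemma is_sup_cong:
  assumes "\<And>v x. v \<le> w \<Longrightarrow> v \<le> S x \<longleftrightarrow> v \<le> T x" and "w \<le> is_sup D S u"
  shows "w \<le> is_sup D T u"
  using assms unfolding le_is_sup by (meson order_trans)

lemma le_is_basis:
  "w \<le> is_basis D B \<longleftrightarrow>
    w \<le> dcpo D \<and> w \<le> Subsets D B \<and>
    (\<forall>x. \<forall>v\<le>w. v \<le> elem D x \<longrightarrow>
      v \<le> directed D (\<lambda>b. B b \<^bold>\<and> way_below D b x) \<and>
      v \<le> is_sup D (\<lambda>b. B b \<^bold>\<and> way_below D b x) x)"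
  unfolding is_basis_def le_hball le_inf_iff by blast

lemma is_basis_prod:
  assumes BD: "w \<le> is_basis D BD" and BE: "w \<le> is_basis E BE"
  shows "w \<le> is_basis (D \<^bold>\<otimes> E) (BD \<^bold>\<times> BE)"
  unfolding le_is_basis
proof (intro conjI allI impI)
  show "w \<le> dcpo (D \<^bold>\<otimes> E)"
    using BD BE by (simp add: le_is_basis dcpo_prod)
  show "w \<le> Subsets (D \<^bold>\<otimes> E) (BD \<^bold>\<times> BE)"
    using BD BE by (simp add: le_is_basis Subsets_prod)
next
  fix p v assume v: "v \<le> w" "v \<le> elem (D \<^bold>\<otimes> E) p"
  let ?A = "\<lambda>a. BD a \<^bold>\<and> way_below D a (fst p)"
  let ?B = "\<lambda>b. BE b \<^bold>\<and> way_below E b (snd p)"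
  let ?C = "\<lambda>q. (BD \<^bold>\<times> BE) q \<^bold>\<and> way_below (D \<^bold>\<otimes> E) q p"
  have A: "v \<le> directed D ?A" "v \<le> is_sup D ?A (fst p)"
    and B: "v \<le> directed E ?B" "v \<le> is_sup E ?B (snd p)"
    using BD BE v unfolding le_is_basis by auto
  \<comment> \<open>By the componentwise description of \<open>\<ll>\<close>, the two sets differ
    only in the order of their conjuncts.\<close>
  have C: "u \<le> (?A \<^bold>\<times> ?B) q \<longleftrightarrow> u \<le> ?C q" if "u \<le> v" for u q
  proof -
    have "u \<le> poset D" "u \<le> poset E"
      using BD BE that v(1) by (auto simp: le_is_basis le_dcpo)
    then show ?thesis
      by (auto simp: prod_sub_def way_below_prod)
  qed
  have "v \<le> directed (D \<^bold>\<otimes> E) (?A \<^bold>\<times> ?B)"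
    by (intro directed_prod A B)
  then show "v \<le> directed (D \<^bold>\<otimes> E) ?C"
    by (rule directed_cong[rotated]) (rule C)
  have "v \<le> is_sup (D \<^bold>\<otimes> E) (?A \<^bold>\<times> ?B) (fst p, snd p)"
    using A B unfolding le_directed by (intro is_sup_prod) auto
  then have "v \<le> is_sup (D \<^bold>\<otimes> E) (?A \<^bold>\<times> ?B) p"
    by simp
  then show "v \<le> is_sup (D \<^bold>\<otimes> E) ?C p"
    by (rule is_sup_cong[rotated]) (rule C)
qed

section \<open>Least elements of a product\<close>

lemma pointed_prod:
  assumes D: "w \<le> pointed D" and E: "w \<le> pointed E"
  shows "w \<le> pointed (D \<^bold>\<otimes> E)"
proof (rule le_hexE[OF D[unfolded pointed_def]])
  fix a v assume v: "v \<le> w" "v \<le> is_least D a"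
  show "v \<le> pointed (D \<^bold>\<otimes> E)"
  proof (rule le_hexE[OF order_trans[OF v(1) E[unfolded pointed_def]]])
    fix b u assume u: "u \<le> v" "u \<le> is_least E b"
    have "u \<le> is_least D a"
      using u v by simp
    with u have "u \<le> is_least (D \<^bold>\<otimes> E) (a, b)"
      unfolding le_is_least by simp
    then show "u \<le> pointed (D \<^bold>\<otimes> E)"
      unfolding pointed_def by (rule le_hexI)
  qed
qed

text \<open>An arbitrary \<open>x\<close> in \<open>D\<close> is completed to the pair
  \<open>(x, snd u)\<close>, and \<open>u\<close> lies below that pair.\<close>

lemma is_least_fst:
  assumes "w \<le> is_least (D \<^bold>\<otimes> E) u"
  shows "w \<le> is_least D (fst u)"
  unfolding le_is_least
proof (intro conjI allI impI)
  show "w \<le> elem D (fst u)"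
    using assms by (simp add: le_is_least)
next
  fix x v assume v: "v \<le> w" "v \<le> elem D x"
  then have "v \<le> elem (D \<^bold>\<otimes> E) (x, snd u)"
    using assms by (auto simp: le_is_least)
  then have "v \<le> hle (D \<^bold>\<otimes> E) u (x, snd u)"
    using assms v unfolding le_is_least by blast
  then show "v \<le> hle D (fst u) x"
    by simp
qed

lemma is_least_snd:
  assumes "w \<le> is_least (D \<^bold>\<otimes> E) u"
  shows "w \<le> is_least E (snd u)"
proof -
  have "w \<le> is_least (E \<^bold>\<otimes> D) (prod.swap u)"
    using assms unfolding le_is_least by (simp, blast)
  then show ?thesis
    using is_least_fst by fastforce
qed

text \<open>The components of a least element \<open>u\<close> of the product are least in the
  factors, so the hypotheses decide both componentwise equalities. Equality with \<open>u\<close> is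
  their conjunction.\<close>

lemma decidable_bot_prod:
  assumes D: "w \<le> decidable_bot D BD" and E: "w \<le> decidable_bot E BE"
  shows "w \<le> decidable_bot (D \<^bold>\<otimes> E) (BD \<^bold>\<times> BE)"
  unfolding decidable_bot_def le_INF_iff le_himp le_hball
proof (intro ballI allI impI)
  fix u v p t
  assume "v \<le> w" and u: "v \<le> is_least (D \<^bold>\<otimes> E) u" and "t \<le> v" and p: "t \<le> (BD \<^bold>\<times> BE) p"
  have "t \<le> decidable (heq D (fst p) (fst u))" "t \<le> decidable (heq E (snd p) (snd u))"
    using D E is_least_fst[OF u] is_least_snd[OF u] \<open>v \<le> w\<close> \<open>t \<le> v\<close> p
    unfolding decidable_bot_def le_INF_iff le_himp le_hball by (auto simp: prod_sub_def)
  then show "t \<le> decidable (heq (D \<^bold>\<otimes> E) p u)"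
    by (simp add: decidable_conj)
qed

section \<open>Decidability of the way-below relation and of the order\<close>

lemma decidable_way_below_prod:
  assumes D: "w \<le> poset D" and E: "w \<le> poset E"
    and BD: "w \<le> decidable_way_below D BD" and BE: "w \<le> decidable_way_below E BE"
  shows "w \<le> decidable_way_below (D \<^bold>\<otimes> E) (BD \<^bold>\<times> BE)"
  unfolding decidable_way_below_def le_hball
proof (intro allI impI)
  fix p v q t
  assume "v \<le> w" and p: "v \<le> (BD \<^bold>\<times> BE) p" and "t \<le> v" and q: "t \<le> (BD \<^bold>\<times> BE) q"
  have "t \<le> decidable (way_below D (fst p) (fst q))" "t \<le> decidable (way_below E (snd p) (snd q))"
    using BD BE \<open>v \<le> w\<close> \<open>t \<le> v\<close> p q
    unfolding decidable_way_below_def le_hball by (auto simp: prod_sub_def)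
  then have "t \<le> decidable (way_below D (fst p) (fst q) \<^bold>\<and> way_below E (snd p) (snd q))"
    by (rule decidable_conj)
  then show "t \<le> decidable (way_below (D \<^bold>\<otimes> E) p q)"
  \<comment> \<open>The conjunction may be exchanged for \<open>\<ll>\<close> in the product at all
    worlds below \<open>t\<close>, since \<open>D\<close> and \<open>E\<close> remain posets
    there.\<close>
  proof (rule decidable_cong)
    fix s assume "s \<le> t"
    then have "s \<le> poset D" "s \<le> poset E"
      using D E \<open>v \<le> w\<close> \<open>t \<le> v\<close> by auto
    then show "s \<le> (way_below D (fst p) (fst q) \<^bold>\<and> way_below E (snd p) (snd q)) \<longleftrightarrow>
        s \<le> way_below (D \<^bold>\<otimes> E) p q"
      by (simp add: way_below_prod)
  qed
qed

text \<open>The order of the product is a conjunction by definition, so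
  \<open>decidable_conj\<close> applies directly.\<close>

lemma decidable_le_prod:
  assumes "w \<le> decidable_le D BD" and "w \<le> decidable_le E BE"
  shows "w \<le> decidable_le (D \<^bold>\<otimes> E) (BD \<^bold>\<times> BE)"
  using assms unfolding decidable_le_def le_hball
  by (auto simp: prod_sub_def intro!: decidable_conj)

theorem proposition2p23:
  fixes D :: "('a, 'h::complete_heyting_algebra) hord"
    and E :: "('b, 'h) hord"
    and BD :: "'a \<Rightarrow> 'h"
    and BE :: "'b \<Rightarrow> 'h"
  shows "valid (
    continuous_dcpo D \<^bold>\<and> continuous_dcpo E \<^bold>\<and> is_basis D BD \<^bold>\<and> is_basis E BE
    \<^bold>\<longrightarrow>
      is_basis (D \<^bold>\<otimes> E) (BD \<^bold>\<times> BE) \<^bold>\<and>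
      (pointed D \<^bold>\<and> pointed E \<^bold>\<and> decidable_bot D BD \<^bold>\<and> decidable_bot E BE
        \<^bold>\<longrightarrow> pointed (D \<^bold>\<otimes> E) \<^bold>\<and> decidable_bot (D \<^bold>\<otimes> E) (BD \<^bold>\<times> BE)) \<^bold>\<and>
      (decidable_way_below D BD \<^bold>\<and> decidable_way_below E BE
        \<^bold>\<longrightarrow> decidable_way_below (D \<^bold>\<otimes> E) (BD \<^bold>\<times> BE)) \<^bold>\<and>
      (decidable_le D BD \<^bold>\<and> decidable_le E BE
        \<^bold>\<longrightarrow> decidable_le (D \<^bold>\<otimes> E) (BD \<^bold>\<times> BE)))"
proof -
  \<comment> \<open>The conclusions are proved at an arbitrary world \<open>w\<close>, because the
    inner implications of the theorem are evaluated at worlds smaller than the one where the bases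
    are given.\<close>
  have basis: "w \<le> is_basis (D \<^bold>\<otimes> E) (BD \<^bold>\<times> BE)"
    and pointed: "w \<le> pointed D \<and> w \<le> pointed E \<and>
      w \<le> decidable_bot D BD \<and> w \<le> decidable_bot E BE \<longrightarrow>
      w \<le> pointed (D \<^bold>\<otimes> E) \<and> w \<le> decidable_bot (D \<^bold>\<otimes> E) (BD \<^bold>\<times> BE)"
    and way_below: "w \<le> decidable_way_below D BD \<and> w \<le> decidable_way_below E BE \<longrightarrow>
      w \<le> decidable_way_below (D \<^bold>\<otimes> E) (BD \<^bold>\<times> BE)"
    and le: "w \<le> decidable_le D BD \<and> w \<le> decidable_le E BE \<longrightarrow>
      w \<le> decidable_le (D \<^bold>\<otimes> E) (BD \<^bold>\<times> BE)"
    if "w \<le> is_basis D BD" "w \<le> is_basis E BE" for w :: 'h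
  proof -
    have "w \<le> poset D" "w \<le> poset E"
      using that by (auto simp: le_is_basis le_dcpo)
    then show "w \<le> decidable_way_below D BD \<and> w \<le> decidable_way_below E BE \<longrightarrow>
        w \<le> decidable_way_below (D \<^bold>\<otimes> E) (BD \<^bold>\<times> BE)"
      by (simp add: decidable_way_below_prod)
  qed (use that in \<open>simp_all add: is_basis_prod pointed_prod decidable_bot_prod decidable_le_prod\<close>)
  show ?thesis
    \<comment> \<open>Validity means being forced at \<open>top\<close>. Unfolding turns each
      implication into a statement about smaller worlds, to which the basis hypotheses pass down by
      transitivity.\<close>
    unfolding valid_def top_unique[symmetric] le_himp le_inf_iff
    by (intro allI impI conjI) (meson basis pointed way_below le order_trans)+
qed

end
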